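(* For any positive integer $k$, there exists an intersecting $k$-family $\mathcal{M}_k$ of transversal size $\lceil \frac{k+1}{2} \rceil$ and length $k+1$. Furthermore, the number of vertices in this family is equal to $k(k+1)/2$.
   Context: A $k$-set is a set with $k$ elements. A $k$-family is a collection of $k$-sets; its members are called blocks, and its length (or size) is the number of blocks in it. The set of vertices of a $k$-family $\mathcal{F}$ is $\bigcup_{F \in \mathcal{F}} F$. A $k$-family $\mathcal{F}$ is intersecting if $F \cap G \neq \emptyset$ for all $F, G \in \mathcal{F}$. A set $C$ is a covering set of $\mathcal{F}$ if $C \cap F \neq \emptyset$ for all $F \in \mathcal{F}$. The transversal size of $\mathcal{F}$ is the smallest possible integer $t$ such that there exists a $t$-set that is a covering set of $\mathcal{F}$. *)

theory Defs
  imports Complex_Main "HOL-Library.Multiset"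
begin

definition is_kset :: "nat \<Rightarrow> 'a set \<Rightarrow> bool" where
  "is_kset k S \<longleftrightarrow> finite S \<and> card S = k"

text \<open>Families are multisets of blocks: the only intersecting collection of two 1-sets is one
  block taken twice, so repetitions have to be allowed for a family of length 2 to exist
  when k = 1.\<close>

definition k_family :: "nat \<Rightarrow> 'a set multiset \<Rightarrow> bool" where
  "k_family k \<F> \<longleftrightarrow> (\<forall>F \<in># \<F>. is_kset k F)"

abbreviation family_length :: "'a set multiset \<Rightarrow> nat" where
  "family_length \<F> \<equiv> size \<F>"

definition vertices :: "'a set multiset \<Rightarrow> 'a set" where
  "vertices \<F> = \<Union> (set_mset \<F>)"

definition intersecting :: "'a set multiset \<Rightarrow> bool" where
  "intersecting \<F> \<longleftrightarrow> (\<forall>F \<in># \<F>. \<forall>G \<in># \<F>. F \<inter> G \<noteq> {})"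

definition covering_set :: "'a set \<Rightarrow> 'a set multiset \<Rightarrow> bool" where
  "covering_set C \<F> \<longleftrightarrow> (\<forall>F \<in># \<F>. C \<inter> F \<noteq> {})"

definition transversal_size :: "'a set multiset \<Rightarrow> nat" where
  "transversal_size \<F> = (LEAST t. \<exists>C. is_kset t C \<and> covering_set C \<F>)"

definition no_repeated_blocks :: "'a set multiset \<Rightarrow> bool" where
  "no_repeated_blocks \<F> \<longleftrightarrow> (\<forall>F. count \<F> F \<le> 1)"

end

theory Submission
  imports Defs "HOL-Library.Nat_Bijection"
begin

text \<open>
  The vertices are the edges of the complete graph on \<open>{0..k}\<close>, and the blocks are the \<open>k + 1\<close>
  stars of this graph. Two stars share the edge joining their centres. A covering set is an edge
  cover: an edge meets only two stars, so at least \<open>(k + 1) / 2\<close> edges are needed, and a maximum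
  matching, with one more edge if \<open>k\<close> is even, attains this bound.
\<close>

text \<open>The theorem asks for sets of natural numbers, so an edge is coded as a number. Putting
  the larger endpoint first makes the code independent of the order of the endpoints.\<close>

definition edge :: "nat \<Rightarrow> nat \<Rightarrow> nat" where
  "edge i j = prod_encode (max i j, min i j)"

definition star :: "nat \<Rightarrow> nat \<Rightarrow> nat set" where
  "star k i = edge i ` ({..k} - {i})"

text \<open>The image is taken as a multiset so that equal stars are counted separately: for
  \<open>k = 1\<close> both stars consist of the same single edge, and the length is still
  2.\<close>

definition star_family :: "nat \<Rightarrow> nat set multiset" where
  "star_family k = image_mset (star k) (mset_set {..k})"

lemma edge_eq_iff: "edge i j = edge i' j' \<longleftrightarrow> (i = i' \<and> j = j') \<or> (i = j' \<and> j = i')"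
  by (auto simp: edge_def max_def min_def)

lemma edge_in_star: "i \<le> k \<Longrightarrow> j \<le> k \<Longrightarrow> i \<noteq> j \<Longrightarrow> edge i j \<in> star k i \<inter> star k j"
  by (auto simp: star_def image_iff edge_eq_iff)

text \<open>Decoding recovers the two endpoints of an edge, and the centre of any star containing it
  is one of them. The lower bound for covering sets rests on this.\<close>

lemma mem_star_decode: "v \<in> star k i \<Longrightarrow> i = fst (prod_decode v) \<or> i = snd (prod_decode v)"
  by (auto simp: star_def edge_def max_def min_def split: if_splits)

lemma finite_star: "finite (star k i)"
  by (simp add: star_def)

lemma card_star:
  assumes "i \<le> k"
  shows "card (star k i) = k"
proof -
  have "inj_on (edge i) ({..k} - {i})"
    by (auto simp: inj_on_def edge_eq_iff)
  then show ?thesis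
    using assms by (simp add: star_def card_image)
qed

lemma set_mset_star_family: "set_mset (star_family k) = star k ` {..k}"
  by (simp add: star_family_def)

lemma k_family_star_family: "k_family k (star_family k)"
  by (auto simp: k_family_def is_kset_def set_mset_star_family finite_star card_star)

lemma size_star_family: "size (star_family k) = k + 1"
  by (simp add: star_family_def)

lemma intersecting_star_family:
  assumes "k \<ge> 1"
  shows "intersecting (star_family k)"
proof -
  have "star k i \<inter> star k j \<noteq> {}" if "i \<le> k" "j \<le> k" for i j
  proof (cases "i = j")
    case True
    then show ?thesis
      using card_star[OF that(1)] assms by auto
  next
    case False
    then show ?thesis
      using edge_in_star[OF that] by blast
  qed
  then show ?thesis
    by (auto simp: intersecting_def set_mset_star_family)
qed

text \<open>Ordering the endpoints identifies the edges with the pairs \<open>(j, i)\<close> with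
  \<open>i < j \<le> k\<close>, which can be counted by the larger endpoint.\<close>

lemma vertices_star_family:
  "vertices (star_family k) = prod_encode ` Sigma {..k} (\<lambda>j. {..<j})"
proof
  show "vertices (star_family k) \<subseteq> prod_encode ` Sigma {..k} (\<lambda>j. {..<j})"
    by (auto simp: vertices_def set_mset_star_family star_def edge_def)
  show "prod_encode ` Sigma {..k} (\<lambda>j. {..<j}) \<subseteq> vertices (star_family k)"
  proof clarsimp
    fix i j
    assume "j \<le> k" "i < j"
    then have "prod_encode (j, i) = edge j i" "edge j i \<in> star k j"
      using edge_in_star[of j k i] by (auto simp: edge_def)
    then show "prod_encode (j, i) \<in> vertices (star_family k)"
      using \<open>j \<le> k\<close> by (auto simp: vertices_def set_mset_star_family)
  qed
qed

lemma card_vertices_star_family: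
  "real (card (vertices (star_family k))) = real k * (real k + 1) / 2"
proof -
  have "card (vertices (star_family k)) = (\<Sum>j\<le>k. j)"
    by (simp add: vertices_star_family card_image inj_prod_encode)
  moreover have "2 * (\<Sum>j\<le>k. real j) = real k * (real k + 1)"
    by (induction k) (auto simp: algebra_simps)
  ultimately show ?thesis
    by simp
qed

lemma covering_set_star_family_iff:
  "covering_set C (star_family k) \<longleftrightarrow> (\<forall>i\<le>k. C \<inter> star k i \<noteq> {})"
  by (auto simp: covering_set_def set_mset_star_family)

lemma card_covering_set_star_family:
  assumes "finite C" "covering_set C (star_family k)"
  shows "k + 1 \<le> 2 * card C"
proof -
  let ?f = "fst \<circ> prod_decode" and ?g = "snd \<circ> prod_decode"
  \<comment> \<open>Every centre must be an endpoint of some edge in \<open>C\<close>. Since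
    \<open>prod_decode\<close> is total, elements of \<open>C\<close> that are not edges simply
    contribute two further numbers.\<close>
  have "{..k} \<subseteq> ?f ` C \<union> ?g ` C"
  proof
    fix i
    assume "i \<in> {..k}"
    then obtain v where "v \<in> C" "v \<in> star k i"
      using assms(2) by (auto simp: covering_set_star_family_iff)
    then show "i \<in> ?f ` C \<union> ?g ` C"
      using mem_star_decode[of v k i] by auto
  qed
  then have "card {..k} \<le> card (?f ` C \<union> ?g ` C)"
    using assms(1) by (intro card_mono) auto
  also have "\<dots> \<le> card (?f ` C) + card (?g ` C)"
    by (rule card_Un_le)
  also have "\<dots> \<le> card C + card C"
    using assms(1) by (intro add_mono card_image_le)
  finally show ?thesis
    by simp
qed

lemma ex_covering_set_star_family:
  assumes "k \<ge> 1"
  obtains C where "finite C" "card C \<le> (k + 2) div 2" "covering_set C (star_family k)"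
proof
  \<comment> \<open>For even \<open>k\<close> the reduction modulo \<open>k + 1\<close> turns the last pair \<open>(k, k + 1)\<close> into \<open>(k, 0)\<close>.\<close>
  let ?e = "\<lambda>j. edge (2 * j) ((2 * j + 1) mod (k + 1))"
  let ?C = "?e ` {..<(k + 2) div 2}"
  show "finite ?C"
    by simp
  \<comment> \<open>An inequality avoids checking that the chosen edges are distinct; the reverse
    bound comes from \<open>card_covering_set_star_family\<close>.\<close>
  show "card ?C \<le> (k + 2) div 2"
    using card_image_le[of "{..<(k + 2) div 2}" ?e] by simp
  show "covering_set ?C (star_family k)"
    unfolding covering_set_star_family_iff
  proof (intro allI impI)
    fix i
    assume "i \<le> k"
    define j where "j = i div 2"
    let ?l = "(2 * j + 1) mod (k + 1)"
    have j: "j < (k + 2) div 2" "2 * j \<le> k"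
      using \<open>i \<le> k\<close> by (auto simp: j_def)
    have l: "?l = (if 2 * j = k then 0 else 2 * j + 1)"
      using j by auto
    \<comment> \<open>The endpoints differ even when the pair wraps around: then
      \<open>?l = 0\<close>, while \<open>2 * j = k \<ge> 1\<close>.\<close>
    have "?e j \<in> star k (2 * j) \<inter> star k ?l"
      using j l assms by (intro edge_in_star) (auto split: if_splits)
    moreover have "i = 2 * j \<or> i = ?l"
      using l \<open>i \<le> k\<close> by (cases "even i") (auto simp: j_def elim!: oddE)
    ultimately have "?e j \<in> star k i"
      by auto
    then show "?C \<inter> star k i \<noteq> {}"
      using j by blast
  qed
qed

lemma transversal_size_star_family:
  assumes "k \<ge> 1"
  shows "transversal_size (star_family k) = (k + 2) div 2"
proof -
  let ?P = "\<lambda>t. \<exists>C. is_kset t C \<and> covering_set C (star_family k)"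
  obtain C where C: "finite C" "card C \<le> (k + 2) div 2" "covering_set C (star_family k)"
    using ex_covering_set_star_family[OF assms] .
  then have "?P (card C)"
    by (auto simp: is_kset_def)
  then have "?P (transversal_size (star_family k))" "transversal_size (star_family k) \<le> card C"
    unfolding transversal_size_def by (rule LeastI, rule Least_le)
  \<comment> \<open>The least value is itself attained by a covering set, so the lower bound applies
    to it.\<close>
  moreover from this(1) have "k + 1 \<le> 2 * transversal_size (star_family k)"
    using card_covering_set_star_family by (metis is_kset_def)
  ultimately show ?thesis
    using C(2) by linarith
qed

text \<open>For \<open>k \<ge> 2\<close> there is a third centre \<open>l\<close> besides
  \<open>i\<close> and \<open>j\<close>; the edge from \<open>i\<close> to \<open>l\<close> lies in
  the star of \<open>i\<close> but not in that of \<open>j\<close>.\<close>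

lemma inj_on_star:
  assumes "k \<ge> 2"
  shows "inj_on (star k) {..k}"
proof (rule inj_onI, rule ccontr)
  fix i j
  assume ij: "i \<in> {..k}" "j \<in> {..k}" "star k i = star k j" "i \<noteq> j"
  have "card {i, j} < card {..k}"
    using assms ij(4) by simp
  then have "\<not> {..k} \<subseteq> {i, j}"
    using card_mono[of "{i, j}" "{..k}"] by auto
  then obtain l where l: "l \<le> k" "l \<noteq> i" "l \<noteq> j"
    by auto
  then have "edge i l \<in> star k j"
    using edge_in_star[of i k l] ij by auto
  then show False
    using l ij by (auto simp: star_def edge_eq_iff)
qed

lemma no_repeated_blocks_star_family:
  assumes "k \<ge> 2"
  shows "no_repeated_blocks (star_family k)"
  using inj_on_star[OF assms]
  by (simp add: no_repeated_blocks_def star_family_def image_mset_mset_set count_mset_set')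

theorem lemma1p1:
  fixes k :: nat
  assumes "k \<ge> 1"
  shows "\<exists>\<M> :: nat set multiset.
           k_family k \<M> \<and> intersecting \<M> \<and>
           int (transversal_size \<M>) = \<lceil>(real k + 1) / 2\<rceil> \<and>
           family_length \<M> = k + 1 \<and>
           real (card (vertices \<M>)) = real k * (real k + 1) / 2 \<and>
           (k \<ge> 2 \<longrightarrow> no_repeated_blocks \<M>)"
proof -
  have "int ((k + 2) div 2) = \<lceil>(real k + 1) / 2\<rceil>"
    by (cases "even k") (auto elim!: evenE oddE intro!: ceiling_unique[symmetric])
  then have "int (transversal_size (star_family k)) = \<lceil>(real k + 1) / 2\<rceil>"
    using transversal_size_star_family[OF assms] by simp
  then show ?thesis
    using k_family_star_family intersecting_star_family[OF assms] size_star_family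
      card_vertices_star_family no_repeated_blocks_star_family
    by blast
qed

end
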